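(* For each integer $n\ge 2$, we have $\mathcal{S}_n\subset D_{1.6}$.
   Context: For a positive integer $n$ let $\mathcal{P}_n(z):=\sum_{k=0}^n \frac{(nz)^k}{k!}$ (with $0^0=1$) and $\mathcal{S}_n:=\{z\in\mathbb{C} : |\mathcal{P}_n(z)|\le 1\}$. For $\varrho>0$, $D_\varrho:=\{z\in\mathbb{C}: |z|\le\varrho\}$ is the closed disk of radius $\varrho$ centered at $0$. *)

theory Defs
  imports "HOL-Analysis.Analysis"
begin

definition scaled_exp_poly :: "nat \<Rightarrow> complex \<Rightarrow> complex" where
  "scaled_exp_poly n z = (\<Sum>k=0..n. (of_nat n * z) ^ k / fact k)"

definition sublevel_set :: "nat \<Rightarrow> complex set" where
  "sublevel_set n = {z. cmod (scaled_exp_poly n z) \<le> 1}"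

end

theory Submission
  imports Defs
begin

text \<open>The coefficients \<open>a k = n ^ k / k!\<close> of the polynomial increase for \<open>k \<le> n\<close>, and the last two,
  \<open>a (n - 1)\<close> and \<open>a n\<close>, coincide. As in the Enestrom--Kakeya theorem, multiplication by \<open>z - 1\<close>
  turns the coefficients into differences of neighbours, which telescope when they are added up.
  Equality of the last two makes the coefficient of \<open>z ^ n\<close> vanish, so that the leading term
  \<open>a n * z ^ (n + 1)\<close> competes only with powers up to \<open>z ^ (n - 1)\<close>, of total weight \<open>a n\<close>.
  With \<open>r = cmod z \<ge> 1\<close> this gives
  \<open>a n * r ^ (n - 1) * (r\<^sup>2 - 1) \<le> cmod ((z - 1) * P z)\<close>, and dividing by
  \<open>cmod (z - 1) \<le> r + 1\<close> leaves \<open>a n * r ^ (n - 1) * (r - 1) \<le> cmod (P z)\<close>.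
  For \<open>n \<ge> 2\<close> and \<open>r > 1.6\<close> the left-hand side exceeds \<open>2 * 1.6 * 0.6 > 1\<close>, because
  \<open>n! \<le> n ^ (n - 1)\<close> implies \<open>a n \<ge> n\<close>.\<close>

text \<open>Beside its leading term, the product with \<open>z - 1\<close> has the coefficients \<open>- a 0\<close> and
  \<open>a k - a (k + 1)\<close> for \<open>k < m\<close>, whose absolute values telescope to \<open>a m\<close>.\<close>

lemma norm_times_minus_one_diff_lead_le:
  fixes a :: "nat \<Rightarrow> real" and z :: complex
  assumes "0 \<le> a 0" and mono: "\<And>k. k < m \<Longrightarrow> a k \<le> a (Suc k)" and z: "1 \<le> cmod z"
  shows "cmod ((z - 1) * (\<Sum>k\<le>m. of_real (a k) * z ^ k) - of_real (a m) * z ^ Suc m)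
           \<le> a m * cmod z ^ m"
  using mono
proof (induction m)
  case 0
  have "(z - 1) * of_real (a 0) - of_real (a 0) * z = - of_real (a 0)"
    by (simp add: algebra_simps)
  then show ?case using \<open>0 \<le> a 0\<close> by simp
next
  case (Suc m)
  define L where
    "L j = (z - 1) * (\<Sum>k\<le>j. of_real (a k) * z ^ k) - of_real (a j) * z ^ Suc j" for j
  have IH: "cmod (L m) \<le> a m * cmod z ^ m"
    using Suc by (simp add: L_def)
  have step: "a m \<le> a (Suc m)" using Suc.prems by simp
  have "0 \<le> a m * cmod z ^ m" using IH norm_ge_zero order_trans by blast
  moreover have "0 < cmod z ^ m" using z by (intro zero_less_power) linarith
  ultimately have am: "0 \<le> a m" by (simp add: zero_le_mult_iff)
  have "L (Suc m) = L m - of_real (a (Suc m) - a m) * z ^ Suc m"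
    by (simp add: L_def algebra_simps)
  then have "cmod (L (Suc m)) \<le> cmod (L m) + cmod (of_real (a (Suc m) - a m) * z ^ Suc m)"
    using norm_triangle_ineq4 by simp
  also have "cmod (of_real (a (Suc m) - a m) * z ^ Suc m)
      = (a (Suc m) - a m) * cmod z ^ Suc m"
    unfolding norm_mult norm_power norm_of_real using step by simp
  also have "cmod (L m) \<le> a m * cmod z ^ Suc m"
    using IH am z by (meson le_SucI mult_left_mono order_refl order_trans power_increasing)
  finally show ?case by (simp add: L_def algebra_simps)
qed

text \<open>By the previous estimate the leading term of the product with \<open>z - 1\<close>, of degree \<open>m + 2\<close>,
  stands against a remainder of degree \<open>m\<close>. The gap of two degrees supplies the factor
  \<open>(cmod z)\<^sup>2 - 1\<close>, which absorbs the division by \<open>cmod (z - 1) \<le> cmod z + 1\<close>.\<close>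

lemma norm_poly_ge_of_increasing_coeffs:
  fixes a :: "nat \<Rightarrow> real" and z :: complex
  assumes "0 \<le> a 0" and mono: "\<And>k. k < m \<Longrightarrow> a k \<le> a (Suc k)"
    and top: "a (Suc m) = a m" and z: "1 \<le> cmod z"
  shows "a m * cmod z ^ m * (cmod z - 1) \<le> cmod (\<Sum>k\<le>Suc m. of_real (a k) * z ^ k)"
proof -
  define r where "r = cmod z"
  define S where "S = (\<Sum>k\<le>Suc m. of_real (a k) * z ^ k)"
  \<comment> \<open>Since \<open>a (Suc m) = a m\<close>, the terms with \<open>z ^ Suc m\<close> cancel, and the remainder is the one of
    degree \<open>m\<close>: applying the bound at \<open>Suc m\<close> would lose a factor \<open>r\<close>.\<close>
  have "(z - 1) * S - of_real (a m) * z ^ Suc (Suc m)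
      = (z - 1) * (\<Sum>k\<le>m. of_real (a k) * z ^ k) - of_real (a m) * z ^ Suc m"
    by (simp add: S_def top algebra_simps)
  then have rest: "cmod ((z - 1) * S - of_real (a m) * z ^ Suc (Suc m)) \<le> a m * r ^ m"
    using norm_times_minus_one_diff_lead_le[of a m z] assms by (simp add: r_def)
  have "0 \<le> a m * r ^ m" using rest norm_ge_zero order_trans by blast
  moreover have "0 < r ^ m" using z unfolding r_def by (intro zero_less_power) linarith
  ultimately have am: "0 \<le> a m" by (simp add: zero_le_mult_iff)
  have lead: "cmod (of_real (a m) * z ^ Suc (Suc m)) = a m * r ^ Suc (Suc m)"
    unfolding norm_mult norm_power norm_of_real r_def using am by simp
  have "(r + 1) * (a m * r ^ m * (r - 1)) = a m * r ^ Suc (Suc m) - a m * r ^ m"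
    by (simp add: algebra_simps)
  also have "\<dots> \<le> cmod ((z - 1) * S)"
    using rest lead norm_triangle_ineq2[of "of_real (a m) * z ^ Suc (Suc m)" "(z - 1) * S"]
    by (simp only: norm_minus_commute)
  also have "\<dots> \<le> (r + 1) * cmod S"
    unfolding norm_mult r_def using norm_triangle_ineq4[of z 1]
    by (intro mult_right_mono) auto
  finally show ?thesis
    using z by (simp add: r_def S_def mult_le_cancel_left)
qed

lemma fact_Suc_le_power: "fact (Suc m) \<le> Suc m ^ m"
proof -
  have "fact (Suc m) = (\<Prod>i=2..Suc m. i)"
    by (simp add: fact_prod prod.atLeast_Suc_atMost numeral_2_eq_2)
  also have "\<dots> \<le> (\<Prod>i=2..Suc m. Suc m)"
    by (intro prod_mono) auto
  finally show ?thesis by simp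
qed

theorem corollary2p4:
  fixes n :: nat
  assumes "n \<ge> 2"
  shows "sublevel_set n \<subseteq> cball 0 1.6"
proof
  fix z assume "z \<in> sublevel_set n"
  then have small: "cmod (scaled_exp_poly n z) \<le> 1" by (simp add: sublevel_set_def)
  obtain m where n: "n = Suc m" and m: "1 \<le> m"
    using assms by (cases n) auto
  define a :: "nat \<Rightarrow> real" where "a k = real n ^ k / fact k" for k
  have poly: "scaled_exp_poly n z = (\<Sum>k\<le>Suc m. of_real (a k) * z ^ k)"
    unfolding scaled_exp_poly_def n atMost_atLeast0
    by (intro sum.cong) (auto simp: a_def n power_mult_distrib)
  have ratio: "a (Suc k) = a k * (real n / real (Suc k))" for k
    by (simp add: a_def mult.commute)
  have mono: "a k \<le> a (Suc k)" if "k < m" for k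
  proof -
    have "1 \<le> real n / real (Suc k)" using that n by simp
    moreover have "0 \<le> a k" by (simp add: a_def)
    ultimately show ?thesis unfolding ratio by (metis mult.right_neutral mult_left_mono)
  qed
  have top: "a (Suc m) = a m" unfolding ratio n by simp
  have "real (fact n) \<le> real (n ^ m)"
    using fact_Suc_le_power[of m] unfolding n of_nat_le_iff .
  then have "real n * fact n \<le> real n ^ n"
    unfolding n by (simp add: mult_left_mono del: fact_Suc)
  then have "real n \<le> a n"
    by (simp add: a_def le_divide_eq)
  then have a2: "2 \<le> a m" using assms top n by simp
  show "z \<in> cball 0 1.6"
  proof (rule ccontr)
    assume "z \<notin> cball 0 1.6"
    then have r: "1.6 < cmod z" by simp
    have "cmod z ^ 1 \<le> cmod z ^ m"
      using r m by (intro power_increasing) auto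
    then have lower: "2 * 1.6 \<le> a m * cmod z ^ m"
      using a2 r by (intro mult_mono) auto
    have "2 * 1.6 * 0.6 \<le> a m * cmod z ^ m * (cmod z - 1)"
      by (rule mult_mono) (use lower r in linarith)+
    also have "\<dots> \<le> cmod (scaled_exp_poly n z)"
      unfolding poly using mono top r
      by (intro norm_poly_ge_of_increasing_coeffs) (auto simp: a_def)
    finally show False using small by simp
  qed
qed

end
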